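(* Let $p,r$ be positive integers. Let $\mathcal{F}$ be a finite family of compact convex sets in $\mathbb{R}^2$ with no isolated sets, and let $\mathcal{F}'=\{S\cap S' \mid S,S'\in\mathcal{F},\ S\neq S',\ S\cap S'\neq\emptyset\}$ be the family of its pairwise intersections. If $\mathcal{F}$ has the $(p+1,2)$ property and $\mathcal{F}'$ has the $(r+1,2)$ property, then $$\tau(\mathcal{F})\le \left(\left\lfloor \tfrac{r}{2} \right\rfloor^2+\left\lfloor \tfrac{r}{2}\right\rfloor\right)p \quad\text{when } r\ge 2,$$ and $\tau(\mathcal{F})\le p$ when $r=1$.
   Context: For integers $m\ge q>0$, a family of sets has the $(m,q)$ property if among any $m$ (distinct) members of it some $q$ have a nonempty common intersection (the property holds vacuously if the family has fewer than $m$ members). A set in $\mathcal{F}$ is isolated if it does not intersect any other set in $\mathcal{F}$; in particular, if $\mathcal{F}$ has no isolated sets, then every set in $\mathcal{F}$ is nonempty. A family $\mathcal{F}$ is pierced by $k$ points if there is a set $C\subseteq\bigcup\mathcal{F}$ with $|C|=k$ such that every $F\in\mathcal{F}$ contains a point of $C$. The piercing number $\tau(\mathcal{F})$ is the smallest $k$ such that $\mathcal{F}$ is pierced by $k$ points. *)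

theory Defs
  imports "HOL-Analysis.Analysis"
begin

text \<open>Families are sets of sets, so their members are distinct.
  The property is meant for \<open>m \<ge> q > 0\<close>; the sets \<open>G\<close> and \<open>H\<close> are then finite.\<close>

definition mq_property :: "nat \<Rightarrow> nat \<Rightarrow> 'a set set \<Rightarrow> bool" where
  "mq_property m q F \<longleftrightarrow>
     (\<forall>G. G \<subseteq> F \<and> card G = m \<longrightarrow> (\<exists>H. H \<subseteq> G \<and> card H = q \<and> \<Inter>H \<noteq> {}))"

text \<open>An empty member of \<open>F\<close> is isolated, and so is the only member of a one-element family.\<close>

definition isolated_member :: "'a set \<Rightarrow> 'a set set \<Rightarrow> bool" where
  "isolated_member S F \<longleftrightarrow> S \<in> F \<and> (\<forall>T\<in>F. T \<noteq> S \<longrightarrow> S \<inter> T = {})"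

definition pairwise_intersections :: "'a set set \<Rightarrow> 'a set set" where
  "pairwise_intersections F = {S \<inter> T | S T. S \<in> F \<and> T \<in> F \<and> S \<noteq> T \<and> S \<inter> T \<noteq> {}}"

definition pierced_by :: "'a set set \<Rightarrow> nat \<Rightarrow> bool" where
  "pierced_by F k \<longleftrightarrow>
     (\<exists>C. C \<subseteq> \<Union>F \<and> finite C \<and> card C = k \<and> (\<forall>S\<in>F. S \<inter> C \<noteq> {}))"

text \<open>Meaningful only when some \<open>k\<close> exists; by the lemma that follows, this is the case for
  every finite family of nonempty sets, hence for every finite family without isolated sets.\<close>

definition piercing_number :: "'a set set \<Rightarrow> nat" where
  "piercing_number F = (LEAST k. pierced_by F k)"

lemma pierced_by_exists:
  assumes "finite F" and "{} \<notin> F"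
  shows "\<exists>k. pierced_by F k"
proof -
  have "\<forall>S\<in>F. \<exists>x. x \<in> S"
    using assms(2) by (metis ex_in_conv)
  then obtain f where f: "\<forall>S\<in>F. f S \<in> S"
    by metis
  have "f ` F \<subseteq> \<Union>F" "finite (f ` F)" "\<forall>S\<in>F. S \<inter> f ` F \<noteq> {}"
    using f assms(1) by auto
  then show ?thesis
    unfolding pierced_by_def by blast
qed

lemma no_isolated_imp_nonempty:
  assumes "\<forall>S\<in>F. \<not> isolated_member S F"
  shows "{} \<notin> F"
  using assms by (auto simp: isolated_member_def)

end

theory Submission
  imports Defs
begin

text \<open>
  Among the pairs of distinct, intersecting members of the family take a pair \<open>S\<close>, \<open>T\<close> for which
  \<open>S \<inter> T\<close> is farthest from the origin, let \<open>q\<close> be the point of \<open>S \<inter> T\<close> closest to the origin and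
  \<open>B\<close> the closed ball around the origin through \<open>q\<close>. If \<open>U\<close> meets \<open>S \<inter> T\<close>, then any three of
  \<open>S, T, U, B\<close> have a common point, so by Helly's theorem all four do, and since
  \<open>S \<inter> T \<inter> B = {q}\<close>, the point \<open>q\<close> lies in \<open>U\<close>.
  Hence the pairwise intersections of the members that avoid \<open>q\<close> are all disjoint from \<open>S \<inter> T\<close>,
  and discarding the members through \<open>q\<close> lowers \<open>r\<close> by one. When no pairwise intersections are
  left, at most \<open>p\<close> members are left, and even at most \<open>p - 1\<close> if the last step had \<open>r = 1\<close>: then
  \<open>S\<close> is disjoint from all of them. So \<open>r + p - 1\<close> points suffice, which is at most the
  claimed bound unless \<open>r = 3\<close> and \<open>p = 1\<close>. In that case the members avoiding \<open>q\<close> intersect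
  pairwise and three of them without a common point would give three disjoint pairwise
  intersections, so by Helly's theorem they share one further point.
\<close>

section \<open>The (m,2) property and pairwise intersections\<close>

lemma mq_propertyD:
  assumes "mq_property m 2 F" "G \<subseteq> F" "card G = m"
  obtains A B where "A \<in> G" "B \<in> G" "A \<noteq> B" "A \<inter> B \<noteq> {}"
proof -
  obtain H where "H \<subseteq> G" "card H = 2" "\<Inter>H \<noteq> {}"
    using assms unfolding mq_property_def by blast
  then obtain A B where "H = {A, B}" "A \<noteq> B"
    by (meson card_2_iff)
  with \<open>H \<subseteq> G\<close> \<open>\<Inter>H \<noteq> {}\<close> show thesis
    by (intro that[of A B]) auto
qed

lemma mq_propertyI:
  assumes "\<And>G. G \<subseteq> F \<Longrightarrow> card G = m \<Longrightarrow> \<exists>A\<in>G. \<exists>B\<in>G. A \<noteq> B \<and> A \<inter> B \<noteq> {}"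
  shows "mq_property m 2 F"
  unfolding mq_property_def
proof (intro allI impI)
  fix G assume "G \<subseteq> F \<and> card G = m"
  then obtain A B where "A \<in> G" "B \<in> G" "A \<noteq> B" "A \<inter> B \<noteq> {}"
    using assms by blast
  then show "\<exists>H\<subseteq>G. card H = 2 \<and> \<Inter>H \<noteq> {}"
    by (intro exI[of _ "{A, B}"]) auto
qed

lemma mq_property_subset:
  "mq_property m q F \<Longrightarrow> G \<subseteq> F \<Longrightarrow> mq_property m q G"
  unfolding mq_property_def by blast

lemma pairwise_intersections_iff:
  "X \<in> pairwise_intersections F \<longleftrightarrow>
     (\<exists>S\<in>F. \<exists>T\<in>F. S \<noteq> T \<and> S \<inter> T \<noteq> {} \<and> X = S \<inter> T)"
  unfolding pairwise_intersections_def by auto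

lemma finite_pairwise_intersections:
  assumes "finite F"
  shows "finite (pairwise_intersections F)"
proof (rule finite_subset)
  show "pairwise_intersections F \<subseteq> (\<lambda>(S, T). S \<inter> T) ` (F \<times> F)"
    by (auto simp: pairwise_intersections_iff)
qed (use assms in auto)

lemma card_disjoint_le:
  assumes "finite F" "mq_property (p + 1) 2 F" "pairwise_intersections F = {}"
  shows "card F \<le> p"
proof (rule ccontr)
  assume "\<not> card F \<le> p"
  then obtain G where G: "G \<subseteq> F" "card G = p + 1"
    using obtain_subset_with_card_n[of "p + 1" F] by auto
  then obtain A B where "A \<in> G" "B \<in> G" "A \<noteq> B" "A \<inter> B \<noteq> {}"
    using mq_propertyD[OF assms(2)] by metis
  with G(1) have "A \<inter> B \<in> pairwise_intersections F"
    unfolding pairwise_intersections_iff by blast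
  with assms(3) show False by blast
qed

section \<open>Helly's theorem and the choice of a piercing point\<close>

text \<open>Helly's theorem counts members of a set of sets, so three of them have to be distinct;
  \<open>D\<close> may coincide with one of these, as the ball might with a member of the
  family.\<close>

lemma helly_four_in_plane:
  fixes A B C D :: "'a::euclidean_space set"
  assumes "DIM('a) = 2" "convex A" "convex B" "convex C" "convex D"
    and distinct: "A \<noteq> B" "A \<noteq> C" "B \<noteq> C"
    and triples: "A \<inter> B \<inter> C \<noteq> {}" "A \<inter> B \<inter> D \<noteq> {}" "A \<inter> C \<inter> D \<noteq> {}" "B \<inter> C \<inter> D \<noteq> {}"
  shows "A \<inter> B \<inter> C \<inter> D \<noteq> {}"
proof -
  have "\<Inter>{A, B, C, D} \<noteq> {}"
  proof (rule Helly)
    have "card {A, B, C} \<le> card {A, B, C, D}"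
      by (rule card_mono) auto
    with distinct assms(1) show "DIM('a) + 1 \<le> card {A, B, C, D}" by simp
    show "\<forall>s\<in>{A, B, C, D}. convex s" using assms by simp
    fix t assume t: "t \<subseteq> {A, B, C, D}" "card t = DIM('a) + 1"
    have "t \<subseteq> {A, B, C} \<or> t \<subseteq> {A, B, D} \<or> t \<subseteq> {A, C, D} \<or> t \<subseteq> {B, C, D}"
    proof (cases "D \<in> {A, B, C}")
      case True
      with t(1) have "t \<subseteq> {A, B, C}" by auto
      then show ?thesis by simp
    next
      case False
      then have "A \<noteq> D" "B \<noteq> D" "C \<noteq> D" by blast+
      with distinct have "card {A, B, C, D} = 4" by simp
      with t(2) assms(1) have "t \<noteq> {A, B, C, D}" by auto
      with t(1) have "A \<notin> t \<or> B \<notin> t \<or> C \<notin> t \<or> D \<notin> t" by blast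
      moreover have "D \<notin> t \<Longrightarrow> t \<subseteq> {A, B, C}" "C \<notin> t \<Longrightarrow> t \<subseteq> {A, B, D}"
        "B \<notin> t \<Longrightarrow> t \<subseteq> {A, C, D}" "A \<notin> t \<Longrightarrow> t \<subseteq> {B, C, D}"
        using t(1) by blast+
      ultimately show ?thesis by argo
    qed
    moreover have "\<Inter>{A, B, C} \<noteq> {}" "\<Inter>{A, B, D} \<noteq> {}" "\<Inter>{A, C, D} \<noteq> {}" "\<Inter>{B, C, D} \<noteq> {}"
      using triples by auto
    ultimately show "\<Inter>t \<noteq> {}"
      by (metis Inter_anti_mono subset_empty)
  qed
  then show ?thesis by auto
qed

lemma exists_piercing_point:
  fixes F :: "'a::euclidean_space set set"
  assumes dim: "DIM('a) = 2" and "finite F" and F: "\<forall>S\<in>F. closed S \<and> convex S"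
    and "pairwise_intersections F \<noteq> {}"
  obtains S T q where "S \<in> F" "T \<in> F" "S \<noteq> T" "q \<in> S \<inter> T"
    "\<And>U. U \<in> F \<Longrightarrow> U \<inter> (S \<inter> T) \<noteq> {} \<Longrightarrow> q \<in> U"
proof -
  let ?q = "\<lambda>X. closest_point X (0::'a)"
  let ?N = "(\<lambda>X. norm (?q X)) ` pairwise_intersections F"
  have N: "finite ?N" "?N \<noteq> {}"
    using assms(2,4) finite_pairwise_intersections by auto
  then obtain X where X: "X \<in> pairwise_intersections F" "norm (?q X) = Max ?N"
    using Max_in by (metis (no_types, lifting) imageE)
  then obtain S T where ST: "S \<in> F" "T \<in> F" "S \<noteq> T" "S \<inter> T \<noteq> {}" "X = S \<inter> T"
    unfolding pairwise_intersections_iff by blast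
  define q where "q = ?q (S \<inter> T)"
  define B where "B = cball (0::'a) (norm q)"
  have cc: "closed (S \<inter> T)" "convex (S \<inter> T)"
    using ST F by (auto intro: convex_Int)
  have q: "q \<in> S \<inter> T"
    unfolding q_def using cc(1) ST(4) by (rule closest_point_in_set)
  \<comment> \<open>By the maximal choice of \<open>X\<close>, the point of
    \<open>V \<inter> W\<close> closest to the origin has norm at most
    \<open>norm q\<close>.\<close>
  have meets_B: "V \<inter> W \<inter> B \<noteq> {}" if "V \<in> F" "W \<in> F" "V \<noteq> W" "V \<inter> W \<noteq> {}" for V W
  proof -
    have "V \<inter> W \<in> pairwise_intersections F"
      using that unfolding pairwise_intersections_iff by blast
    then have "norm (?q (V \<inter> W)) \<le> norm q"
      using Max_ge[OF N(1)] X(2) ST(5) unfolding q_def by fastforce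
    moreover have "?q (V \<inter> W) \<in> V \<inter> W"
      using that F by (intro closest_point_in_set) auto
    ultimately show ?thesis unfolding B_def by auto
  qed
  \<comment> \<open>The closest point of a closed convex set is unique, so every other point of
    \<open>S \<inter> T\<close> lies outside the ball.\<close>
  have STB: "S \<inter> T \<inter> B \<subseteq> {q}"
  proof
    fix x assume x: "x \<in> S \<inter> T \<inter> B"
    then show "x \<in> {q}"
      using closest_point_lt[OF cc(2,1), of x 0] unfolding B_def q_def by auto
  qed
  have "q \<in> U" if "U \<in> F" "U \<inter> (S \<inter> T) \<noteq> {}" for U
  proof (cases "U = S \<or> U = T")
    case True
    with q show ?thesis by auto
  next
    case False
    have "S \<inter> T \<inter> U \<inter> B \<noteq> {}"
    proof (rule helly_four_in_plane[OF dim])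
      show "S \<inter> T \<inter> U \<noteq> {}" using that(2) by blast
      show "S \<inter> T \<inter> B \<noteq> {}" using ST by (intro meets_B)
      show "S \<inter> U \<inter> B \<noteq> {}" using ST(1) that False by (intro meets_B) auto
      show "T \<inter> U \<inter> B \<noteq> {}" using ST(2) that False by (intro meets_B) auto
    qed (use ST that F False in \<open>auto simp: B_def\<close>)
    with STB show ?thesis by blast
  qed
  with ST q show thesis by (intro that)
qed

section \<open>Removing the members through a point\<close>

lemma pairwise_intersections_avoiding_point:
  assumes "S \<in> F" "T \<in> F" "S \<noteq> T" "S \<inter> T \<noteq> {}"
    and "\<And>U. U \<in> F \<Longrightarrow> U \<inter> (S \<inter> T) \<noteq> {} \<Longrightarrow> q \<in> U"
    and "mq_property (Suc m) 2 (pairwise_intersections F)" "finite F"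
  shows "mq_property m 2 (pairwise_intersections {U \<in> F. q \<notin> U})"
proof (rule mq_propertyI)
  let ?F1 = "{U \<in> F. q \<notin> U}"
  fix G assume G: "G \<subseteq> pairwise_intersections ?F1" "card G = m"
  \<comment> \<open>A member that meets \<open>S \<inter> T\<close> contains \<open>q\<close>, so it
    is not in \<open>?F1\<close>.\<close>
  have disj: "X \<inter> (S \<inter> T) = {}" if "X \<in> G" for X
    using that G(1) assms(5) by (force simp: pairwise_intersections_iff)
  have "finite G"
    using G(1) by (rule finite_subset) (simp add: assms(7) finite_pairwise_intersections)
  moreover have "S \<inter> T \<notin> G"
    using disj assms(4) by auto
  ultimately have "card (insert (S \<inter> T) G) = Suc m"
    using G(2) by simp
  moreover have "insert (S \<inter> T) G \<subseteq> pairwise_intersections F"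
  proof -
    have "S \<inter> T \<in> pairwise_intersections F"
      using assms(1-4) unfolding pairwise_intersections_iff by blast
    moreover have "pairwise_intersections ?F1 \<subseteq> pairwise_intersections F"
      unfolding pairwise_intersections_def by blast
    ultimately show ?thesis using G(1) by blast
  qed
  ultimately obtain X Y where "X \<in> insert (S \<inter> T) G" "Y \<in> insert (S \<inter> T) G" "X \<noteq> Y" "X \<inter> Y \<noteq> {}"
    using mq_propertyD[OF assms(6)] by metis
  \<comment> \<open>Since \<open>S \<inter> T\<close> meets no member of \<open>G\<close>, both sets
    come from \<open>G\<close>.\<close>
  with disj show "\<exists>X\<in>G. \<exists>Y\<in>G. X \<noteq> Y \<and> X \<inter> Y \<noteq> {}"
    by blast
qed

lemma pierced_by_card:
  assumes "finite F" "{} \<notin> F"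
  shows "\<exists>k\<le>card F. pierced_by F k"
proof -
  have "\<forall>S\<in>F. \<exists>x. x \<in> S"
    using assms(2) by (metis ex_in_conv)
  then obtain f where f: "\<forall>S\<in>F. f S \<in> S"
    by metis
  then have "pierced_by F (card (f ` F))"
    unfolding pierced_by_def using assms(1) by (intro exI[of _ "f ` F"]) auto
  with card_image_le[OF assms(1), of f] show ?thesis by blast
qed

lemma pierced_by_Suc:
  assumes "pierced_by {U \<in> F. q \<notin> U} k" "q \<in> \<Union>F"
  shows "pierced_by F (Suc k)"
proof -
  obtain C where C: "C \<subseteq> \<Union>{U \<in> F. q \<notin> U}" "finite C" "card C = k"
      "\<forall>S\<in>{U \<in> F. q \<notin> U}. S \<inter> C \<noteq> {}"
    using assms(1) unfolding pierced_by_def by blast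
  \<comment> \<open>\<open>pierced_by\<close> fixes the exact number of points, so \<open>q\<close>
    has to be a new one.\<close>
  from C(1) have "q \<notin> C" by auto
  with C assms(2) show ?thesis
    unfolding pierced_by_def by (intro exI[of _ "insert q C"]) auto
qed

section \<open>Piercing by at most r + p - 1 points\<close>

text \<open>Here \<open>n\<close> stands for r - 1, so that the induction starts at r = 1, where one
  point is saved. The members are assumed nonempty, which passes to subfamilies, whereas removing
  members may create isolated ones.\<close>

lemma pierced_by_less_sum:
  fixes F :: "'a::euclidean_space set set"
  assumes "DIM('a) = 2" "p > 0" "finite F" "\<forall>S\<in>F. closed S \<and> convex S" "{} \<notin> F"
    and "mq_property (p + 1) 2 F"
    and "mq_property (Suc (Suc n)) 2 (pairwise_intersections F)"
  shows "\<exists>k\<le>n + p. pierced_by F k"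
  using assms(3-)
proof (induction n arbitrary: F)
  case (0 F)
  show ?case
  proof (cases "pairwise_intersections F = {}")
    case True
    then show ?thesis
      using card_disjoint_le[OF \<open>finite F\<close>] pierced_by_card[OF \<open>finite F\<close>] 0 le_trans by fastforce
  next
    case False
    then obtain S T q where ST: "S \<in> F" "T \<in> F" "S \<noteq> T" "q \<in> S \<inter> T"
      and q: "\<And>U. U \<in> F \<Longrightarrow> U \<inter> (S \<inter> T) \<noteq> {} \<Longrightarrow> q \<in> U"
      using exists_piercing_point[OF assms(1)] 0 by metis
    let ?F1 = "{U \<in> F. q \<notin> U}"
    \<comment> \<open>If \<open>U\<close> avoided \<open>q\<close>, then \<open>U \<inter> V\<close>
      and \<open>S \<inter> T\<close> would be two disjoint pairwise intersections, which r = 1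
      excludes.\<close>
    have int: "q \<in> U" if "U \<in> F" "V \<in> F" "U \<noteq> V" "U \<inter> V \<noteq> {}" for U V
    proof (rule ccontr)
      assume "q \<notin> U"
      then have dis: "(U \<inter> V) \<inter> (S \<inter> T) = {}" using q that by blast
      with that have "card {U \<inter> V, S \<inter> T} = 2" by (auto simp: card_2_iff)
      moreover have "{U \<inter> V, S \<inter> T} \<subseteq> pairwise_intersections F"
        using that ST by (auto simp: pairwise_intersections_iff)
      ultimately obtain X Y where "X \<in> {U \<inter> V, S \<inter> T}" "Y \<in> {U \<inter> V, S \<inter> T}" "X \<noteq> Y" "X \<inter> Y \<noteq> {}"
        using mq_propertyD[OF 0(5)] by (metis numeral_2_eq_2)
      with dis show False by auto
    qed
    \<comment> \<open>Members avoiding \<open>q\<close> meet no other member. Adding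
      \<open>S\<close>, which contains \<open>q\<close>, gives one more disjoint set, so
      \<open>?F1\<close> has at most p - 1 members.\<close>
    have "pairwise_intersections (insert S ?F1) = {}"
      using int ST by (auto simp: pairwise_intersections_iff) blast+
    moreover have "mq_property (p + 1) 2 (insert S ?F1)"
      using 0(4) by (rule mq_property_subset) (use ST in auto)
    ultimately have "card (insert S ?F1) \<le> p"
      using 0(1) by (intro card_disjoint_le) auto
    moreover have "card (insert S ?F1) = Suc (card ?F1)"
      using 0(1) ST by simp
    moreover obtain k where "k \<le> card ?F1" "pierced_by ?F1 k"
      using pierced_by_card[of ?F1] 0 by auto
    ultimately show ?thesis
      using pierced_by_Suc[of F q k] ST by (intro exI[of _ "Suc k"]) auto
  qed
next
  case (Suc n F)
  show ?case
  proof (cases "pairwise_intersections F = {}")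
    case True
    then have "card F \<le> p"
      using Suc by (intro card_disjoint_le) auto
    then show ?thesis
      using pierced_by_card[of F] Suc.prems by (meson le_trans le_add2)
  next
    case False
    then obtain S T q where ST: "S \<in> F" "T \<in> F" "S \<noteq> T" "q \<in> S \<inter> T"
      and q: "\<And>U. U \<in> F \<Longrightarrow> U \<inter> (S \<inter> T) \<noteq> {} \<Longrightarrow> q \<in> U"
      using exists_piercing_point[OF assms(1)] Suc.prems by metis
    have "\<exists>k\<le>n + p. pierced_by {U \<in> F. q \<notin> U} k"
    proof (rule Suc.IH)
      show "mq_property (Suc (Suc n)) 2 (pairwise_intersections {U \<in> F. q \<notin> U})"
        using ST q Suc.prems by (intro pairwise_intersections_avoiding_point[of S F T]) auto
      show "mq_property (p + 1) 2 {U \<in> F. q \<notin> U}"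
        using Suc.prems(4) by (rule mq_property_subset) auto
    qed (use Suc.prems in auto)
    then obtain k where "k \<le> n + p" "pierced_by {U \<in> F. q \<notin> U} k" by blast
    then show ?thesis
      using pierced_by_Suc[of F q k] ST by (intro exI[of _ "Suc k"]) auto
  qed
qed

section \<open>The exceptional case r = 3 and p = 1\<close>

lemma pairwise_intersecting_Inter_nonempty:
  fixes F :: "'a::euclidean_space set set"
  assumes "DIM('a) = 2" "finite F" "\<forall>S\<in>F. convex S" "{} \<notin> F"
    and "mq_property 2 2 F" "mq_property 3 2 (pairwise_intersections F)"
  shows "\<Inter>F \<noteq> {}"
proof (cases "card F \<ge> 3")
  case True
  have meet: "A \<inter> B \<noteq> {}" if "A \<in> F" "B \<in> F" "A \<noteq> B" for A B
    by (rule mq_propertyD[OF assms(5), of "{A, B}"]) (use that in auto)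
  show ?thesis
  proof (rule Helly)
    fix t assume t: "t \<subseteq> F" "card t = DIM('a) + 1"
    then obtain A B C where ABC: "t = {A, B, C}" "A \<noteq> B" "B \<noteq> C" "A \<noteq> C"
      using assms(1) by (auto simp: card_3_iff)
    with t(1) have F: "A \<in> F" "B \<in> F" "C \<in> F" by auto
    show "\<Inter>t \<noteq> {}"
    proof
      assume "\<Inter>t = {}"
      then have dis: "A \<inter> B \<inter> C = {}" using ABC(1) by auto
      have ne: "A \<inter> B \<noteq> {}" "A \<inter> C \<noteq> {}" "B \<inter> C \<noteq> {}"
        using ABC F meet by auto
      let ?G = "{A \<inter> B, A \<inter> C, B \<inter> C}"
      \<comment> \<open>Any two of these nonempty sets meet only in
        \<open>A \<inter> B \<inter> C\<close>, which is empty.\<close>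
      have "A \<inter> B \<noteq> A \<inter> C" "A \<inter> B \<noteq> B \<inter> C" "A \<inter> C \<noteq> B \<inter> C"
        using dis ne by blast+
      then have "card ?G = 3" by simp
      moreover have "?G \<subseteq> pairwise_intersections F"
        using ne F ABC unfolding pairwise_intersections_def by blast
      ultimately obtain X Y where "X \<in> ?G" "Y \<in> ?G" "X \<noteq> Y" "X \<inter> Y \<noteq> {}"
        using mq_propertyD[OF assms(6)] by metis
      with dis show False by auto
    qed
  qed (use True assms in auto)
next
  case False
  \<comment> \<open>Families too small for Helly's theorem are checked directly; the empty one has
    intersection \<open>UNIV\<close>.\<close>
  then have "card F = 0 \<or> card F = 1 \<or> card F = 2" by linarith
  then show ?thesis
  proof (elim disjE)
    assume "card F = 2"
    then obtain A B where "A \<in> F" "B \<in> F" "A \<noteq> B" "A \<inter> B \<noteq> {}"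
      using mq_propertyD[OF assms(5), of F] by auto
    with \<open>card F = 2\<close> show ?thesis
      by (auto simp: card_2_iff)
  qed (use assms(2,4) in \<open>auto simp: card_1_singleton_iff\<close>)
qed

lemma pierced_by_two:
  fixes F :: "'a::euclidean_space set set"
  assumes "DIM('a) = 2" "finite F" "\<forall>S\<in>F. closed S \<and> convex S" "{} \<notin> F"
    and "mq_property 2 2 F" "mq_property 4 2 (pairwise_intersections F)"
  shows "\<exists>k\<le>2. pierced_by F k"
proof (cases "pairwise_intersections F = {}")
  case True
  then have "card F \<le> 1"
    using assms by (intro card_disjoint_le) (auto simp: numeral_2_eq_2)
  then show ?thesis
    using pierced_by_card[of F] assms(2,4) by (meson le_trans one_le_numeral)
next
  case False
  then obtain S T q where ST: "S \<in> F" "T \<in> F" "S \<noteq> T" "q \<in> S \<inter> T"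
    and q: "\<And>U. U \<in> F \<Longrightarrow> U \<inter> (S \<inter> T) \<noteq> {} \<Longrightarrow> q \<in> U"
    using exists_piercing_point[OF assms(1)] assms by metis
  let ?F1 = "{U \<in> F. q \<notin> U}"
  have "mq_property 3 2 (pairwise_intersections ?F1)"
    using ST q assms by (intro pairwise_intersections_avoiding_point[of S F T]) auto
  moreover have "mq_property 2 2 ?F1"
    using assms(5) by (rule mq_property_subset) auto
  ultimately have "\<Inter>?F1 \<noteq> {}"
    using assms by (intro pairwise_intersecting_Inter_nonempty) auto
  then obtain z where z: "z \<in> \<Inter>?F1" by blast
  have "\<exists>k\<le>1. pierced_by ?F1 k"
  \<comment> \<open>If \<open>?F1\<close> is empty, \<open>z\<close> is arbitrary and lies outside
    its union, so zero points are taken.\<close>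
  proof (cases "?F1 = {}")
    case True
    then have "pierced_by ?F1 0" unfolding pierced_by_def by (intro exI[of _ "{}"]) simp
    then show ?thesis by blast
  next
    case False
    with z have "pierced_by ?F1 1"
      unfolding pierced_by_def by (intro exI[of _ "{z}"]) auto
    then show ?thesis by blast
  qed
  then obtain k where "k \<le> 1" "pierced_by ?F1 k" by blast
  then show ?thesis
    using pierced_by_Suc[of F q k] ST by (intro exI[of _ "Suc k"]) auto
qed

section \<open>Comparison with the claimed bound\<close>

theorem theorem1p1:
  fixes p r :: nat and F :: "(real ^ 2) set set"
  assumes "p > 0" and "r > 0"
    and "finite F"
    and "\<forall>S\<in>F. compact S \<and> convex S"
    and "\<forall>S\<in>F. \<not> isolated_member S F"
    and "mq_property (p + 1) 2 F"
    and "mq_property (r + 1) 2 (pairwise_intersections F)"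
  shows "(r \<ge> 2 \<longrightarrow> piercing_number F \<le> ((r div 2)\<^sup>2 + r div 2) * p)
       \<and> (r = 1 \<longrightarrow> piercing_number F \<le> p)"
proof -
  have F: "\<forall>S\<in>F. closed S \<and> convex S"
    using assms(4) compact_imp_closed by blast
  have ne: "{} \<notin> F"
    using assms(5) by (rule no_isolated_imp_nonempty)
  have dim: "DIM(real ^ 2) = 2" by simp
  have number_le: "piercing_number F \<le> b" if "\<exists>k\<le>b. pierced_by F k" for b
    using that Least_le[of "pierced_by F"] unfolding piercing_number_def by (meson le_trans)
  obtain n where n: "r = Suc n" using assms(2) gr0_conv_Suc by blast
  have le: "piercing_number F \<le> n + p"
    using assms(7) n
    by (intro number_le pierced_by_less_sum[OF dim assms(1,3) F ne assms(6)]) simp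
  have "piercing_number F \<le> ((r div 2)\<^sup>2 + r div 2) * p" if "r \<ge> 2"
  \<comment> \<open>In this case r + p - 1 = 3 exceeds the claimed bound 2.\<close>
  proof (cases "r = 3 \<and> p = 1")
    case True
    then have "piercing_number F \<le> 2"
      using assms by (intro number_le pierced_by_two[OF dim assms(3) F ne]) (auto simp: numeral_2_eq_2)
    with True show ?thesis by simp
  next
    case False
    define s where "s = r div 2"
    have s: "s \<ge> 1" "r \<le> 2 * s + 1" using that unfolding s_def by auto
    obtain d where d: "p = Suc d" using assms(1) gr0_conv_Suc by blast
    have "n + p \<le> (s\<^sup>2 + s) * p"
    \<comment> \<open>For \<open>s = 1\<close> the claim is \<open>n \<le> p\<close> with
      \<open>n \<le> 2\<close>, which fails only for the excluded pair.\<close>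
    proof (cases "s = 1")
      case True
      with False that n s assms(1) show ?thesis unfolding s_def by auto
    next
      case False
      \<comment> \<open>The chain is \<open>n + 1 = r \<le> 2 * s + 1 \<le> s\<^sup>2 + s\<close>,
        and \<open>n \<le> n * p\<close> handles the factor \<open>p\<close>.\<close>
      with s have "2 * s \<le> s\<^sup>2" "2 \<le> s" by (auto simp: power2_eq_square)
      with s n have "n + 1 \<le> s\<^sup>2 + s" by linarith
      then have "(n + 1) * p \<le> (s\<^sup>2 + s) * p" by (rule mult_right_mono) simp
      moreover have "n + p \<le> (n + 1) * p" by (simp add: d)
      ultimately show ?thesis by linarith
    qed
    with le show ?thesis unfolding s_def by linarith
  qed
  moreover have "piercing_number F \<le> p" if "r = 1"
    using le n that by simp
  ultimately show ?thesis by blast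
qed

end
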